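(* Let $G$ be an interlacement graph of an Euler system of a 4-regular graph $F$, and let $k$ be a positive integer. If $F$ has a $k$-circuit (a circuit of size $k$), then $G$ has a transverse circuit of size $\leq k$.
   Context: All graphs are finite. A 4-regular graph may have loops and multiple edges. A circuit in a graph is a closed walk of positive length using no edge (half-edge) more than once; vertices may repeat. Circuits differing only in starting point or orientation are identified. The size of a circuit is its number of edges. An Euler system $C$ of a 4-regular graph $F$ is a set containing precisely one Euler circuit of each connected component of $F$. The interlacement graph $\mathcal{I}(C)$ is the simple graph with vertex set $V(F)$ in which $v\neq w$ are adjacent iff they appear in the cyclic order $v\ldots w\ldots v\ldots w$ on one of the circuits of $C$. For a simple graph $G$ with adjacency matrix $A$ over $GF(2)$, let $IAS(G)=(I\ \ A\ \ I+A)$ over $GF(2)$, $I$ the $V(G)\times V(G)$ identity matrix. The $v$ columns of $I$, $A$, $I+A$ are labelled $\phi_G(v),\chi_G(v),\psi_G(v)$; $W(G)$ is the set of these $3|V(G)|$ labels, and $M[IAS(G)]$ is the binary matroid on $W(G)$ represented by $IAS(G)$. The vertex triple of $v$ is $\{\phi_G(v),\chi_G(v),\psi_G(v)\}$. A transversal of $W(G)$ is a subset containing exactly one element of each vertex triple. A transverse circuit of $G$ is a matroid circuit of $M[IAS(G)]$ contained in a transversal. *)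

theory Defs
  imports Main "HOL-Library.Z2"
begin

text \<open>
  An edge \<open>e\<close> has the two half-edges \<open>(e, False)\<close> and \<open>(e, True)\<close>; \<open>endpt\<close> gives the vertex to
  which a half-edge is attached. So loops and parallel edges are allowed, and a loop contributes
  two half-edges at its vertex. The labels \<open>False\<close>, \<open>True\<close> carry no orientation.
\<close>

record ('v, 'e) mgraph =
  mverts :: "'v set"
  medges :: "'e set"
  endpt :: "'e \<times> bool \<Rightarrow> 'v"

definition half_edges :: "('v, 'e) mgraph \<Rightarrow> ('e \<times> bool) set" where
  "half_edges F = medges F \<times> UNIV"

definition mgraph :: "('v, 'e) mgraph \<Rightarrow> bool" where
  "mgraph F \<longleftrightarrow> finite (mverts F) \<and> finite (medges F) \<and> endpt F ` half_edges F \<subseteq> mverts F"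

definition mdegree :: "('v, 'e) mgraph \<Rightarrow> 'v \<Rightarrow> nat" where
  "mdegree F v = card {h \<in> half_edges F. endpt F h = v}"

definition four_regular :: "('v, 'e) mgraph \<Rightarrow> bool" where
  "four_regular F \<longleftrightarrow> mgraph F \<and> (\<forall>v\<in>mverts F. mdegree F v = 4)"

fun opp :: "'e \<times> bool \<Rightarrow> 'e \<times> bool" where
  "opp (e, b) = (e, \<not> b)"

definition adj_rel :: "('v, 'e) mgraph \<Rightarrow> ('v \<times> 'v) set" where
  "adj_rel F = {(endpt F h, endpt F (opp h)) | h. h \<in> half_edges F}"

definition components :: "('v, 'e) mgraph \<Rightarrow> 'v set set" where
  "components F = mverts F // {(u, v). u \<in> mverts F \<and> v \<in> mverts F \<and> (u, v) \<in> (adj_rel F)\<^sup>*}"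

definition component_edges :: "('v, 'e) mgraph \<Rightarrow> 'v set \<Rightarrow> 'e set" where
  "component_edges F K = {e \<in> medges F. \<forall>b. endpt F (e, b) \<in> K}"

text \<open>
  A closed walk is the list of half-edges through which it leaves its successive vertices: entry
  \<open>h\<close> traverses the edge \<open>fst h\<close> from \<open>endpt F h\<close> to \<open>endpt F (opp h)\<close>. Its cyclic sequence of
  vertices is \<open>map (endpt F) w\<close>.
\<close>

definition closed_trails :: "('v, 'e) mgraph \<Rightarrow> ('e \<times> bool) list set" where
  "closed_trails F = {w. w \<noteq> [] \<and> set w \<subseteq> half_edges F \<and> distinct (map fst w) \<and>
     (\<forall>i<length w. endpt F (opp (w ! i)) = endpt F (w ! (Suc i mod length w)))}"

definition reverse_walk :: "('e \<times> bool) list \<Rightarrow> ('e \<times> bool) list" where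
  "reverse_walk w = rev (map opp w)"

definition same_circuit :: "('v, 'e) mgraph \<Rightarrow> (('e \<times> bool) list \<times> ('e \<times> bool) list) set" where
  "same_circuit F = {(w, w'). w \<in> closed_trails F \<and> w' \<in> closed_trails F \<and>
     (\<exists>n. w' = rotate n w \<or> w' = rotate n (reverse_walk w))}"

definition circuits :: "('v, 'e) mgraph \<Rightarrow> ('e \<times> bool) list set set" where
  "circuits F = closed_trails F // same_circuit F"

definition circuit_edges :: "('e \<times> bool) list set \<Rightarrow> 'e set" where
  "circuit_edges c = (\<Union>w\<in>c. fst ` set w)"

definition circuit_size :: "('e \<times> bool) list set \<Rightarrow> nat" where
  "circuit_size c = card (circuit_edges c)"

definition euler_circuit :: "('v, 'e) mgraph \<Rightarrow> 'v set \<Rightarrow> ('e \<times> bool) list set \<Rightarrow> bool" where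
  "euler_circuit F K c \<longleftrightarrow> c \<in> circuits F \<and> circuit_edges c = component_edges F K"

definition euler_system :: "('v, 'e) mgraph \<Rightarrow> ('e \<times> bool) list set set \<Rightarrow> bool" where
  "euler_system F C \<longleftrightarrow>
     (\<forall>c\<in>C. \<exists>K\<in>components F. euler_circuit F K c) \<and>
     (\<forall>K\<in>components F. \<exists>!c. c \<in> C \<and> euler_circuit F K c)"

lemma reverse_walk_reverse_walk [simp]: "reverse_walk (reverse_walk w) = w"
proof -
  have "opp (opp h) = h" for h :: "'a \<times> bool"
    by (cases h) simp
  then show ?thesis
    by (simp add: reverse_walk_def rev_map comp_def)
qed

lemma reverse_walk_rotate: "\<exists>m. reverse_walk (rotate n w) = rotate m (reverse_walk w)"
proof -
  have "\<exists>m. rev (rotate n u) = rotate m (rev u)" for u :: "('a \<times> bool) list"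
  proof (cases "u = []")
    case False
    have "rev (rotate n u) = rotate (length u - n mod length u) (rev u)"
      by (metis length_rev rev_rev_ident rotate_rev)
    then show ?thesis by blast
  qed simp
  then show ?thesis
    by (simp add: reverse_walk_def flip: rotate_map)
qed

lemma rotate_back: "\<exists>m. rotate m (rotate n w) = w"
proof -
  have "rotate ((length w - 1) * n) (rotate n w) = rotate (length w * n) w"
    by (cases w) (simp_all add: rotate_rotate add.commute)
  also have "\<dots> = w"
    by (simp add: rotate_id)
  finally show ?thesis ..
qed

lemma equiv_same_circuit: "equiv (closed_trails F) (same_circuit F)"
proof (rule equivI)
  show "same_circuit F \<subseteq> closed_trails F \<times> closed_trails F"
    by (auto simp: same_circuit_def)
  show "refl_on (closed_trails F) (same_circuit F)"
    by (auto simp: refl_on_def same_circuit_def intro: exI[of _ 0])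
  show "sym (same_circuit F)"
    unfolding sym_def same_circuit_def
    by clarsimp (metis reverse_walk_reverse_walk reverse_walk_rotate rotate_back)
  show "trans (same_circuit F)"
    unfolding trans_def same_circuit_def
    by clarsimp (metis reverse_walk_reverse_walk reverse_walk_rotate rotate_rotate)
qed

record 'v sgraph =
  sverts :: "'v set"
  sedges :: "'v set set"

text \<open>
  Linear positions suffice for the cyclic order, because a circuit, as an equivalence class,
  contains all rotations of its closed trails.
\<close>

definition interlaced :: "'v list \<Rightarrow> 'v \<Rightarrow> 'v \<Rightarrow> bool" where
  "interlaced vs v w \<longleftrightarrow>
     (\<exists>i j k l. i < j \<and> j < k \<and> k < l \<and> l < length vs \<and>
        vs ! i = v \<and> vs ! j = w \<and> vs ! k = v \<and> vs ! l = w)"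

definition interlacement_graph ::
    "('v, 'e) mgraph \<Rightarrow> ('e \<times> bool) list set set \<Rightarrow> 'v sgraph" where
  "interlacement_graph F C = \<lparr>sverts = mverts F,
     sedges = {{v, w} | v w. v \<in> mverts F \<and> w \<in> mverts F \<and> v \<noteq> w \<and>
       (\<exists>c\<in>C. \<exists>u\<in>c. interlaced (map (endpt F) u) v w)}\<rparr>"

record 'a matroid =
  ground :: "'a set"
  indep :: "'a set \<Rightarrow> bool"

text \<open>
  The columns are treated as an indexed family, so equal columns with different labels are
  dependent.
\<close>

definition matrix_matroid :: "'r set \<Rightarrow> 'c set \<Rightarrow> ('r \<Rightarrow> 'c \<Rightarrow> 'f::field) \<Rightarrow> 'c matroid" where
  "matrix_matroid R E A = \<lparr>ground = E,
     indep = (\<lambda>S. S \<subseteq> E \<and> finite S \<and>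
       (\<forall>a. (\<forall>r\<in>R. (\<Sum>x\<in>S. a x * A r x) = 0) \<longrightarrow> (\<forall>x\<in>S. a x = 0)))\<rparr>"

definition matroid_circuit :: "'a matroid \<Rightarrow> 'a set \<Rightarrow> bool" where
  "matroid_circuit M X \<longleftrightarrow> X \<subseteq> ground M \<and> \<not> indep M X \<and> (\<forall>Y. Y \<subset> X \<longrightarrow> indep M Y)"

datatype 'v label = Phi 'v | Chi 'v | Psi 'v

definition vertex_triple :: "'v \<Rightarrow> 'v label set" where
  "vertex_triple v = {Phi v, Chi v, Psi v}"

definition W :: "'v sgraph \<Rightarrow> 'v label set" where
  "W G = (\<Union>v\<in>sverts G. vertex_triple v)"

definition identity_matrix :: "'v \<Rightarrow> 'v \<Rightarrow> bit" where
  "identity_matrix v w = (if v = w then 1 else 0)"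

definition adjacency_matrix :: "'v sgraph \<Rightarrow> 'v \<Rightarrow> 'v \<Rightarrow> bit" where
  "adjacency_matrix G v w = (if {v, w} \<in> sedges G then 1 else 0)"

fun IAS :: "'v sgraph \<Rightarrow> 'v \<Rightarrow> 'v label \<Rightarrow> bit" where
  "IAS G r (Phi v) = identity_matrix r v"
| "IAS G r (Chi v) = adjacency_matrix G r v"
| "IAS G r (Psi v) = identity_matrix r v + adjacency_matrix G r v"

definition isotropic_matroid :: "'v sgraph \<Rightarrow> 'v label matroid" where
  "isotropic_matroid G = matrix_matroid (sverts G) (W G) (IAS G)"

definition transversal :: "'v sgraph \<Rightarrow> 'v label set \<Rightarrow> bool" where
  "transversal G T \<longleftrightarrow> T \<subseteq> W G \<and> (\<forall>v\<in>sverts G. \<exists>!x. x \<in> T \<inter> vertex_triple v)"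

definition transverse_circuit :: "'v sgraph \<Rightarrow> 'v label set \<Rightarrow> bool" where
  "transverse_circuit G X \<longleftrightarrow>
     matroid_circuit (isotropic_matroid G) X \<and> (\<exists>T. transversal G T \<and> X \<subseteq> T)"

end

theory Submission
  imports Defs
begin

text \<open>
  A shortest closed trail \<open>w\<close> visits each vertex at most once, and at each visited vertex it
  follows one of the three pairings of the half-edges, which correspond to \<open>\<phi>\<close>, \<open>\<chi>\<close>, \<open>\<psi>\<close>. The
  columns so selected sum to zero: let \<open>f\<close> be the indicator over \<open>GF(2)\<close> of the edges of \<open>w\<close>,
  and follow an Euler circuit between its two passages of a vertex \<open>r\<close>. The value of \<open>f\<close> changes
  exactly at the passages of vertices labelled \<open>\<chi>\<close> or \<open>\<psi>\<close>, and such a vertex is passed an odd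
  number of times iff it is interlaced with \<open>r\<close>. So the \<open>A\<close>-part of row \<open>r\<close> is the difference of
  the values of \<open>f\<close> at the two ends of the segment, and this is cancelled by the \<open>I\<close>-part.
\<close>

section \<open>Half-edges and visits of closed trails\<close>

lemma fst_opp [simp]: "fst (opp h) = fst h"
  by (cases h) simp

lemma opp_opp [simp]: "opp (opp h) = h"
  by (cases h) simp

lemma opp_half_edges [simp]: "opp h \<in> half_edges F \<longleftrightarrow> h \<in> half_edges F"
  by (cases h) (auto simp: half_edges_def)

text \<open>A trail traverses each of its edges once, so each edge belongs to one position
  \<open>i\<close> and has the halves \<open>u ! i\<close> and \<open>opp (u ! i)\<close>.\<close>

lemma sum_half_edges_walk:
  fixes g :: "'e \<times> bool \<Rightarrow> 'a::comm_monoid_add"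
  assumes "distinct (map fst u)"
  shows "(\<Sum>h\<in>fst ` set u \<times> UNIV. g h) = (\<Sum>i<length u. g (u ! i) + g (opp (u ! i)))"
proof -
  have inj: "inj_on (\<lambda>i. fst (u ! i)) {..<length u}"
    using assms by (auto simp: inj_on_def distinct_conv_nth)
  have im: "fst ` set u = (\<lambda>i. fst (u ! i)) ` {..<length u}"
    by (auto simp: set_conv_nth)
  have two: "g (fst h, False) + g (fst h, True) = g h + g (opp h)" for h
    by (cases h; cases "snd h") (auto simp: add.commute)
  have "(\<Sum>h\<in>fst ` set u \<times> UNIV. g h) = (\<Sum>e\<in>fst ` set u. \<Sum>b\<in>UNIV. g (e, b))"
    by (simp add: sum.cartesian_product)
  also have "\<dots> = (\<Sum>i<length u. g (fst (u ! i), False) + g (fst (u ! i), True))"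
    unfolding im sum.reindex[OF inj] by (simp add: UNIV_bool)
  finally show ?thesis by (simp only: two)
qed

text \<open>The cyclic predecessor of \<open>i\<close>: a closed trail arrives at its
  \<open>i\<close>-th vertex through \<open>opp (u ! prev_index u i)\<close>.\<close>

definition prev_index :: "'a list \<Rightarrow> nat \<Rightarrow> nat" where
  "prev_index u i = (if i = 0 then length u - 1 else i - 1)"

lemma bij_betw_prev_index: "bij_betw (prev_index u) {..<length u} {..<length u}"
  by (rule bij_betw_byWitness[where f' = "\<lambda>i. Suc i mod length u"])
    (auto simp: prev_index_def mod_Suc)

lemma closed_trail_prev:
  assumes "u \<in> closed_trails F" "i < length u"
  shows "endpt F (opp (u ! prev_index u i)) = endpt F (u ! i)"
proof -
  have "prev_index u i < length u" "Suc (prev_index u i) mod length u = i"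
    using assms(2) by (auto simp: prev_index_def)
  then show ?thesis using assms(1) by (auto simp: closed_trails_def)
qed

text \<open>Each visit uses two half-edges: it leaves by \<open>u ! i\<close> and arrives by the
  other half of the preceding edge. A constant \<open>g\<close> counts visits; an indicator
  \<open>g\<close> counts the half-edges shared with another trail.\<close>

lemma sum_half_edges_at:
  fixes g :: "'e \<times> bool \<Rightarrow> nat"
  assumes u: "u \<in> closed_trails F"
  shows "(\<Sum>h | h \<in> fst ` set u \<times> UNIV \<and> endpt F h = v. g h) =
    (\<Sum>i | i < length u \<and> endpt F (u ! i) = v. g (u ! i) + g (opp (u ! prev_index u i)))"
proof -
  let ?g = "\<lambda>h. if endpt F h = v then g h else 0"
  have "(\<Sum>h | h \<in> fst ` set u \<times> UNIV \<and> endpt F h = v. g h) = (\<Sum>h\<in>fst ` set u \<times> UNIV. ?g h)"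
    by (simp add: sum.inter_filter)
  also have "\<dots> = (\<Sum>i<length u. ?g (u ! i)) + (\<Sum>i<length u. ?g (opp (u ! i)))"
    using u by (subst sum_half_edges_walk) (auto simp: closed_trails_def sum.distrib)
  also have "(\<Sum>i<length u. ?g (opp (u ! i))) = (\<Sum>i<length u. ?g (opp (u ! prev_index u i)))"
    by (rule sum.reindex_bij_betw[OF bij_betw_prev_index, symmetric])
  also have "(\<Sum>i<length u. ?g (u ! i)) + \<dots> =
      (\<Sum>i\<in>{..<length u}. if endpt F (u ! i) = v then g (u ! i) + g (opp (u ! prev_index u i)) else 0)"
    unfolding sum.distrib[symmetric]
    by (rule sum.cong) (auto simp: closed_trail_prev[OF u])
  finally show ?thesis by (simp add: sum.inter_filter[symmetric] lessThan_def)
qed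

text \<open>Two positions \<open>i < j\<close> at the same vertex bound a segment that is itself a
  closed trail, of length \<open>j - i < length u\<close>.\<close>

lemma shortest_closed_trail_distinct:
  assumes u: "u \<in> closed_trails F"
    and min: "\<And>u'. u' \<in> closed_trails F \<Longrightarrow> length u \<le> length u'"
  shows "distinct (map (endpt F) u)"
proof (rule ccontr)
  assume "\<not> ?thesis"
  then obtain i j where ij: "i < j" "j < length u" "endpt F (u ! i) = endpt F (u ! j)"
    by (auto simp: distinct_conv_nth) (metis nat_neq_iff)
  let ?t = "take (j - i) (drop i u)"
  have len: "length ?t = j - i" using ij by simp
  have step: "endpt F (opp (u ! m)) = endpt F (u ! (Suc m mod length u))" if "m < length u" for m
    using u that by (auto simp: closed_trails_def)
  have "endpt F (opp (?t ! m)) = endpt F (?t ! (Suc m mod length ?t))" if m: "m < length ?t" for m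
  proof (cases "Suc m = j - i")
    case True
    then have "i + m < length u" "Suc (i + m) mod length u = j"
      using ij by auto
    with step[of "i + m"] True ij show ?thesis by simp
  next
    case False
    with m have "Suc m < j - i" by simp
    with step[of "i + m"] ij show ?thesis by simp
  qed
  moreover have "distinct (map fst ?t)"
    using u by (auto simp: closed_trails_def take_map[symmetric] drop_map[symmetric])
  moreover have "set ?t \<subseteq> half_edges F"
    using u by (auto simp: closed_trails_def dest!: in_set_takeD in_set_dropD)
  ultimately have "?t \<in> closed_trails F"
    using ij unfolding closed_trails_def by auto
  from min[OF this] len ij show False by simp
qed

text \<open>Rotation and reversal keep the edge set, so any closed trail in the class
  \<open>c\<close> can stand for the circuit.\<close>

lemma circuit_memberD:
  assumes "c \<in> circuits F" "u \<in> c"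
  shows "u \<in> closed_trails F" and "circuit_edges c = fst ` set u"
    and "u' \<in> c \<Longrightarrow> (u, u') \<in> same_circuit F"
proof -
  have same: "(u, u') \<in> same_circuit F" if "u' \<in> c" for u'
    using in_quotient_imp_in_rel[OF equiv_same_circuit, of c] assms that
    by (auto simp: circuits_def)
  then show "u' \<in> c \<Longrightarrow> (u, u') \<in> same_circuit F" .
  show "u \<in> closed_trails F"
    using same[OF assms(2)] by (simp add: same_circuit_def)
  have "fst ` set u' = fst ` set u" if "u' \<in> c" for u'
  proof -
    have "fst ` set (reverse_walk u) = fst ` set u"
      by (simp add: reverse_walk_def image_image)
    then show ?thesis
      using same[OF that] unfolding same_circuit_def mem_Collect_eq prod.case by (metis set_rotate)
  qed
  then show "circuit_edges c = fst ` set u"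
    using assms(2) unfolding circuit_edges_def by (intro SUP_eq_const) blast+
qed

subsection \<open>Interlacement\<close>

text \<open>\<open>interlaced\<close> reads linear positions, and a rotation can turn
  \<open>v w v w\<close> into \<open>w v w v\<close>. This symmetric closure is invariant under
  rotation and reversal.\<close>

definition sym_interlaced :: "'v list \<Rightarrow> 'v \<Rightarrow> 'v \<Rightarrow> bool" where
  "sym_interlaced vs v w \<longleftrightarrow> interlaced vs v w \<or> interlaced vs w v"

lemma interlaced_rotate1:
  assumes "interlaced vs v w"
  shows "sym_interlaced (rotate1 vs) v w"
proof -
  from assms obtain i j k l where ijkl: "i < j" "j < k" "k < l" "l < length vs"
    "vs ! i = v" "vs ! j = w" "vs ! k = v" "vs ! l = w"
    unfolding interlaced_def by blast
  then obtain x xs j' k' l' where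
    vs: "vs = x # xs" and jkl: "j = Suc j'" "k = Suc k'" "l = Suc l'"
    by (cases vs; cases j; cases k; cases l) auto
  have nth: "j' < k'" "k' < l'" "l' < length xs" "xs ! j' = w" "xs ! k' = v" "xs ! l' = w"
    using ijkl by (simp_all add: vs jkl)
  show ?thesis
  proof (cases i)
    case 0
    then have "interlaced (xs @ [x]) w v"
      unfolding interlaced_def
      by (intro exI[of _ j'] exI[of _ k'] exI[of _ l'] exI[of _ "length xs"])
        (use nth ijkl in \<open>simp add: vs nth_append\<close>)
    then show ?thesis by (simp add: sym_interlaced_def vs)
  next
    case (Suc i')
    then have "interlaced (xs @ [x]) v w"
      unfolding interlaced_def
      by (intro exI[of _ i'] exI[of _ j'] exI[of _ k'] exI[of _ l'])
        (use nth ijkl in \<open>simp add: vs jkl nth_append\<close>)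
    then show ?thesis by (simp add: sym_interlaced_def vs)
  qed
qed

lemma sym_interlaced_rotate: "sym_interlaced vs v w \<Longrightarrow> sym_interlaced (rotate n vs) v w"
proof (induction n)
  case (Suc n)
  then show ?case
    using interlaced_rotate1[of "rotate n vs"] by (auto simp: sym_interlaced_def)
qed simp

lemma interlaced_rev:
  assumes "interlaced vs v w"
  shows "interlaced (rev vs) w v"
proof -
  from assms obtain i j k l where ijkl: "i < j" "j < k" "k < l" "l < length vs"
    "vs ! i = v" "vs ! j = w" "vs ! k = v" "vs ! l = w"
    unfolding interlaced_def by blast
  let ?r = "\<lambda>m. length vs - Suc m"
  show ?thesis
    unfolding interlaced_def
    by (intro exI[of _ "?r l"] exI[of _ "?r k"] exI[of _ "?r j"] exI[of _ "?r i"])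
      (use ijkl in \<open>auto simp: rev_nth Suc_diff_Suc\<close>)
qed

lemma sym_interlaced_rev: "sym_interlaced vs v w \<Longrightarrow> sym_interlaced (rev vs) v w"
  unfolding sym_interlaced_def using interlaced_rev by metis

lemma map_endpt_opp:
  assumes "u \<in> closed_trails F"
  shows "map (endpt F \<circ> opp) u = rotate1 (map (endpt F) u)"
  using assms by (intro nth_equalityI) (auto simp: closed_trails_def nth_rotate1)

lemma sym_interlaced_same_circuit:
  assumes "(u, u') \<in> same_circuit F" "sym_interlaced (map (endpt F) u) v w"
  shows "sym_interlaced (map (endpt F) u') v w"
proof -
  have u: "u \<in> closed_trails F"
    and "\<exists>n. u' = rotate n u \<or> u' = rotate n (reverse_walk u)"
    using assms(1) by (auto simp: same_circuit_def)
  then obtain n where "u' = rotate n u \<or> u' = rotate n (reverse_walk u)" by blast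
  \<comment> \<open>An entry of the reversed walk starts at the far end of its edge, hence the shift
    by one place.\<close>
  moreover have "map (endpt F) (reverse_walk u) = rev (rotate 1 (map (endpt F) u))"
    using map_endpt_opp[OF u] by (simp add: reverse_walk_def rev_map comp_def flip: rev_map)
  ultimately show ?thesis
    using assms(2) by (auto simp: rotate_map[symmetric] simp del: rotate_Suc
        intro!: sym_interlaced_rotate sym_interlaced_rev)
qed

lemma card_2_ordered:
  fixes A :: "'a::linorder set"
  assumes "card A = 2"
  obtains a b where "A = {a, b}" "a < b"
proof -
  obtain a b where "A = {a, b}" "a \<noteq> b" using assms by (auto simp: card_2_iff)
  then show ?thesis using that[of a b] that[of b a] by (metis insert_commute linorder_neqE)
qed

text \<open>The two positions of \<open>v\<close> alternate with \<open>p\<close> and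
  \<open>q\<close> exactly when one of them lies strictly between \<open>p\<close> and
  \<open>q\<close> and the other does not.\<close>

lemma sym_interlaced_iff_odd:
  assumes r: "{i. i < length vs \<and> vs ! i = r} = {p, q}" "p < q"
    and v: "card {i. i < length vs \<and> vs ! i = v} = 2" and "v \<noteq> r"
  shows "sym_interlaced vs r v \<longleftrightarrow> odd (card {i. p < i \<and> i < q \<and> vs ! i = v})"
proof -
  obtain a b where ab: "{i. i < length vs \<and> vs ! i = v} = {a, b}" "a < b"
    using card_2_ordered[OF v] by blast
  have pos_r: "i < length vs \<and> vs ! i = r \<longleftrightarrow> i = p \<or> i = q" for i
    using r(1) by blast
  have pos_v: "i < length vs \<and> vs ! i = v \<longleftrightarrow> i = a \<or> i = b" for i
    using ab(1) by blast
  have ne: "p \<noteq> a" "p \<noteq> b" "q \<noteq> a" "q \<noteq> b"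
    using pos_r pos_v \<open>v \<noteq> r\<close> by metis+
  have qn: "q < length vs" and bn: "b < length vs"
    and at: "vs ! p = r" "vs ! q = r" "vs ! a = v" "vs ! b = v"
    using pos_r pos_v by blast+
  have rv: "interlaced vs r v \<longleftrightarrow> p < a \<and> a < q \<and> q < b"
  proof
    assume "interlaced vs r v"
    then obtain i j k l where "i < j" "j < k" "k < l" "l < length vs"
      "vs ! i = r" "vs ! j = v" "vs ! k = r" "vs ! l = v"
      unfolding interlaced_def by blast
    moreover from this have "i = p \<or> i = q" "k = p \<or> k = q" "j = a \<or> j = b" "l = a \<or> l = b"
      using pos_r[of i] pos_r[of k] pos_v[of j] pos_v[of l] by auto
    ultimately show "p < a \<and> a < q \<and> q < b" using r(2) ab(2) by auto
  qed (use at bn in \<open>auto simp: interlaced_def\<close>)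
  have vr: "interlaced vs v r \<longleftrightarrow> a < p \<and> p < b \<and> b < q"
  proof
    assume "interlaced vs v r"
    then obtain i j k l where "i < j" "j < k" "k < l" "l < length vs"
      "vs ! i = v" "vs ! j = r" "vs ! k = v" "vs ! l = r"
      unfolding interlaced_def by blast
    moreover from this have "i = a \<or> i = b" "k = a \<or> k = b" "j = p \<or> j = q" "l = p \<or> l = q"
      using pos_v[of i] pos_v[of k] pos_r[of j] pos_r[of l] by auto
    ultimately show "a < p \<and> p < b \<and> b < q" using r(2) ab(2) by auto
  qed (use at qn in \<open>auto simp: interlaced_def\<close>)
  have eq: "{i. p < i \<and> i < q \<and> vs ! i = v} =
      (if p < a \<and> a < q then {a} else {}) \<union> (if p < b \<and> b < q then {b} else {})"
    (is "?L = ?R")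
  proof (rule set_eqI)
    fix i
    have "i \<in> ?L \<longleftrightarrow> p < i \<and> i < q \<and> (i = a \<or> i = b)"
      using pos_v[of i] qn by auto
    also have "\<dots> \<longleftrightarrow> i \<in> ?R" by auto
    finally show "i \<in> ?L \<longleftrightarrow> i \<in> ?R" .
  qed
  have "odd (card ?L) \<longleftrightarrow> (p < a \<and> a < q) \<noteq> (p < b \<and> b < q)"
    unfolding eq using ab(2) by (cases "p < a \<and> a < q"; cases "p < b \<and> b < q") simp_all
  moreover have "(p < a \<and> a < q \<and> q < b) \<or> (a < p \<and> p < b \<and> b < q) \<longleftrightarrow>
      (p < a \<and> a < q) \<noteq> (p < b \<and> b < q)"
    using ab(2) r(2) ne by (cases "p < a"; cases "a < q"; cases "p < b"; cases "b < q"; simp)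
  ultimately show ?thesis
    unfolding sym_interlaced_def rv vr by simp
qed

subsection \<open>Components\<close>

lemma adj_rel_sym: "sym (adj_rel F)"
proof (rule symI)
  fix a b assume "(a, b) \<in> adj_rel F"
  then obtain h where "h \<in> half_edges F" "a = endpt F h" "b = endpt F (opp h)"
    by (auto simp: adj_rel_def)
  then show "(b, a) \<in> adj_rel F"
    unfolding adj_rel_def by (intro CollectI exI[of _ "opp h"]) simp
qed

lemma equiv_components:
  "equiv (mverts F) {(u, v). u \<in> mverts F \<and> v \<in> mverts F \<and> (u, v) \<in> (adj_rel F)\<^sup>*}"
proof (rule equivI)
  show "sym {(u, v). u \<in> mverts F \<and> v \<in> mverts F \<and> (u, v) \<in> (adj_rel F)\<^sup>*}"
  proof (rule symI)
    fix a b
    assume "(a, b) \<in> {(u, v). u \<in> mverts F \<and> v \<in> mverts F \<and> (u, v) \<in> (adj_rel F)\<^sup>*}"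
    then show "(b, a) \<in> {(u, v). u \<in> mverts F \<and> v \<in> mverts F \<and> (u, v) \<in> (adj_rel F)\<^sup>*}"
      using symD[OF sym_rtrancl[OF adj_rel_sym], of a b F] by simp
  qed
  show "trans {(u, v). u \<in> mverts F \<and> v \<in> mverts F \<and> (u, v) \<in> (adj_rel F)\<^sup>*}"
    by (rule transI) (auto elim: rtrancl_trans)
qed (auto simp: refl_on_def)

lemma component_exists:
  assumes "v \<in> mverts F"
  obtains K where "K \<in> components F" "v \<in> K"
  using equiv_class_self[OF equiv_components assms] quotientI[OF assms]
  unfolding components_def by blast

lemma components_eq:
  assumes "K \<in> components F" "K' \<in> components F" "v \<in> K" "v \<in> K'"
  shows "K = K'"
  using quotient_disj[OF equiv_components, of K F K'] assms unfolding components_def by blast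

lemma component_opp:
  assumes "mgraph F" "K \<in> components F" "h \<in> half_edges F" "endpt F h \<in> K"
  shows "endpt F (opp h) \<in> K"
proof -
  have "endpt F h \<in> mverts F" "endpt F (opp h) \<in> mverts F"
    using assms(1,3) opp_half_edges[of h F] unfolding mgraph_def by blast+
  moreover have "(endpt F h, endpt F (opp h)) \<in> (adj_rel F)\<^sup>*"
    using assms(3) unfolding adj_rel_def by blast
  ultimately show ?thesis
    using in_quotient_imp_closed[OF equiv_components] assms(2,4) unfolding components_def
    by (metis (mono_tags, lifting) case_prodI mem_Collect_eq)
qed

lemma half_edge_in_component:
  assumes "mgraph F" "K \<in> components F" "h \<in> half_edges F" "endpt F h \<in> K"
  shows "fst h \<in> component_edges F K"
proof -
  have "endpt F (fst h, b) \<in> K" for b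
    using assms(4) component_opp[OF assms] by (cases h; cases b; cases "snd h") auto
  then show ?thesis
    using assms(3) by (auto simp: component_edges_def half_edges_def)
qed

subsection \<open>Euler circuits\<close>

text \<open>Every half-edge at a vertex of \<open>K\<close> belongs to an edge of \<open>K\<close>,
  and the Euler trail contains all of these; so counting along the trail is counting in
  \<open>F\<close>.\<close>

lemma euler_trail_half_edges:
  assumes "mgraph F" "K \<in> components F" "euler_circuit F K c" "u \<in> c" "v \<in> K"
  shows "{h. h \<in> fst ` set u \<times> UNIV \<and> endpt F h = v} = {h \<in> half_edges F. endpt F h = v}"
proof -
  have c: "c \<in> circuits F" "circuit_edges c = component_edges F K"
    using assms(3) by (auto simp: euler_circuit_def)
  have "fst ` set u = component_edges F K"
    using circuit_memberD(2)[OF c(1) assms(4)] c(2) by simp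
  moreover have "component_edges F K \<subseteq> medges F" by (auto simp: component_edges_def)
  ultimately show ?thesis
    using half_edge_in_component[OF assms(1,2)] assms(5)
    by (auto simp: half_edges_def mem_Times_iff)
qed

lemma euler_trail_endpt:
  assumes "euler_circuit F K c" "u \<in> c" "i < length u"
  shows "endpt F (u ! i) \<in> K"
proof -
  have c: "c \<in> circuits F" "circuit_edges c = component_edges F K"
    using assms(1) by (auto simp: euler_circuit_def)
  have "fst (u ! i) \<in> component_edges F K"
    using circuit_memberD(2)[OF c(1) assms(2)] c(2) assms(3) by auto
  then show ?thesis
    by (cases "u ! i") (auto simp: component_edges_def)
qed

text \<open>There are four half-edges at \<open>v\<close>, and each visit uses two.\<close>

lemma euler_trail_visits_twice:
  assumes "four_regular F" "K \<in> components F" "euler_circuit F K c" "u \<in> c" "v \<in> K" "v \<in> mverts F"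
  shows "card {i. i < length u \<and> endpt F (u ! i) = v} = 2"
proof -
  have u: "u \<in> closed_trails F"
    using assms circuit_memberD(1) by (auto simp: euler_circuit_def)
  have F: "mgraph F" "mdegree F v = 4" using assms by (auto simp: four_regular_def)
  show ?thesis
    using sum_half_edges_at[OF u, where v = v and g = "\<lambda>_. 1"] F(2)
    unfolding euler_trail_half_edges[OF F(1) assms(2-5)] mdegree_def by simp
qed

text \<open>The graph quantifies over all circuits of \<open>C\<close> and all their
  representatives. One trail \<open>u\<close> suffices for row \<open>r\<close>: a trail of
  \<open>C\<close> through \<open>r\<close> lies in the component of \<open>r\<close>, which has a
  single Euler circuit in \<open>C\<close>, and all its representatives agree on
  \<open>sym_interlaced\<close>.\<close>

lemma interlacement_graph_edge_iff:
  assumes F: "mgraph F" and C: "euler_system F C"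
    and K: "K \<in> components F" and c: "c \<in> C" "euler_circuit F K c" "u \<in> c"
    and r: "r \<in> mverts F" "r \<in> K" and v: "v \<in> mverts F"
  shows "{r, v} \<in> sedges (interlacement_graph F C) \<longleftrightarrow> v \<noteq> r \<and> sym_interlaced (map (endpt F) u) r v"
proof -
  have to_u: "sym_interlaced (map (endpt F) u) x y"
    if c': "c' \<in> C" "u' \<in> c'" and int: "interlaced (map (endpt F) u') x y" and "r = x \<or> r = y"
    for c' u' x y
  proof -
    obtain K' where K': "K' \<in> components F" "euler_circuit F K' c'"
      using bspec[OF conjunct1[OF C[unfolded euler_system_def]] c'(1)] by blast
    have "\<exists>i<length u'. endpt F (u' ! i) = r"
    proof -
      obtain i j where "i < j" "j < length u'" "endpt F (u' ! i) = x" "endpt F (u' ! j) = y"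
        using int unfolding interlaced_def length_map by (metis less_trans nth_map)
      moreover from this have "i < length u'" by simp
      ultimately show ?thesis using \<open>r = x \<or> r = y\<close> by blast
    qed
    then have "r \<in> K'" using euler_trail_endpt[OF K'(2) that(2)] by auto
    then have "K' = K" using components_eq[OF K'(1) K] r by auto
    moreover have "\<exists>!c. c \<in> C \<and> euler_circuit F K c"
      using bspec[OF conjunct2[OF C[unfolded euler_system_def]] K] .
    ultimately have "c' = c" using K'(2) c c'(1) by (elim ex1E) metis
    then have "(u', u) \<in> same_circuit F"
      using circuit_memberD(3) c that by (auto simp: euler_circuit_def)
    then show ?thesis
      by (rule sym_interlaced_same_circuit) (use int in \<open>simp add: sym_interlaced_def\<close>)
  qed
  show ?thesis
  proof
    assume "{r, v} \<in> sedges (interlacement_graph F C)"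
    then obtain x y c' u' where xy: "{r, v} = {x, y}" "x \<noteq> y" "c' \<in> C" "u' \<in> c'"
      "interlaced (map (endpt F) u') x y"
      by (auto simp: interlacement_graph_def)
    then have "r = x \<and> v = y \<or> r = y \<and> v = x" by (auto simp: doubleton_eq_iff)
    with xy to_u[OF xy(3-5)] show "v \<noteq> r \<and> sym_interlaced (map (endpt F) u) r v"
      by (auto simp: sym_interlaced_def)
  next
    assume "v \<noteq> r \<and> sym_interlaced (map (endpt F) u) r v"
    then obtain x y where "{r, v} = {x, y}" "x \<in> mverts F" "y \<in> mverts F" "x \<noteq> y"
      "interlaced (map (endpt F) u) x y"
      unfolding sym_interlaced_def using r v by (metis insert_commute)
    with c show "{r, v} \<in> sedges (interlacement_graph F C)"
      unfolding interlacement_graph_def sgraph.simps by blast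
  qed
qed

subsection \<open>The dependent set of a circuit\<close>

lemma dependent_contains_circuit:
  assumes "finite X" "X \<subseteq> ground M" "\<not> indep M X"
  obtains Y where "Y \<subseteq> X" "matroid_circuit M Y"
proof -
  have "\<exists>Y\<subseteq>X. matroid_circuit M Y"
    using assms
  proof (induction X rule: finite_psubset_induct)
    case (psubset X)
    show ?case
    proof (cases "\<forall>Y. Y \<subset> X \<longrightarrow> indep M Y")
      case True
      with psubset show ?thesis unfolding matroid_circuit_def by blast
    next
      case False
      then obtain Y where "Y \<subset> X" "\<not> indep M Y" by blast
      with psubset show ?thesis by (meson order.trans psubset_imp_subset)
    qed
  qed
  then show ?thesis using that by blast
qed

text \<open>Each intermediate value occurs in two consecutive terms and cancels. For
  \<open>q = p + 1\<close> the sum is empty and the right side is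
  \<open>f p + f p = 0\<close>.\<close>

lemma sum_telescope_char_2:
  fixes f :: "nat \<Rightarrow> 'a::ab_group_add"
  assumes two: "\<And>x::'a. x + x = 0" and "p < q"
  shows "(\<Sum>i\<in>{p<..<q}. f (i - 1) + f i) = f p + f (q - 1)"
proof -
  have "(\<Sum>i\<in>{p<..<p + Suc d}. f (i - 1) + f i) = f p + f (p + d)" for d
  proof (induction d)
    case 0
    have "{p<..<p + Suc 0} = {}" by auto
    then show ?case by (simp add: two)
  next
    case (Suc d)
    have "{p<..<p + Suc (Suc d)} = insert (p + Suc d) {p<..<p + Suc d}" by auto
    then have "(\<Sum>i\<in>{p<..<p + Suc (Suc d)}. f (i - 1) + f i) =
        f p + (f (p + d) + f (p + d)) + f (p + Suc d)"
      using Suc by (simp add: ac_simps)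
    then show ?case by (simp only: two add_0_right)
  qed
  from this[of "q - Suc p"] assms show ?thesis by simp
qed

lemma sum_if_const:
  fixes a :: "'a::semiring_1"
  assumes "finite I"
  shows "(\<Sum>i\<in>I. if P i then a else 0) = of_nat (card {i \<in> I. P i}) * a"
  using assms by (simp add: sum.If_cases Int_def)

lemma bit_add_self: "x + x = (0::bit)"
  by (cases x) simp_all

lemma bit_of_nat: "(of_nat n :: bit) = (if odd n then 1 else 0)"
  by (induction n) auto

text \<open>
  If the four half-edges at \<open>v\<close> are \<open>in, out\<close> on the first passage of the Euler circuit and
  \<open>in', out'\<close> on the second, then \<open>\<phi>\<close> pairs \<open>in\<close> with \<open>out\<close>, \<open>\<chi>\<close> pairs \<open>in\<close> with \<open>out'\<close>, and
  \<open>\<psi>\<close> pairs \<open>in\<close> with \<open>in'\<close>. In the proof, \<open>change v\<close> compares \<open>in\<close> with \<open>out\<close>, and \<open>gap v\<close>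
  compares \<open>out\<close> with \<open>in'\<close>, the first and last edge of the segment between the passages.
\<close>

lemma trail_labels_sum_zero:
  assumes F: "four_regular F" and C: "euler_system F C"
    and w: "w \<in> closed_trails F" "distinct (map (endpt F) w)"
  obtains lab where "\<And>v. lab v \<in> vertex_triple v"
    and "\<And>r. r \<in> mverts F \<Longrightarrow>
      (\<Sum>v\<in>endpt F ` set w. IAS (interlacement_graph F C) r (lab v)) = 0"
proof -
  let ?A = "adjacency_matrix (interlacement_graph F C)"
  let ?W = "endpt F ` set w"
  have mg: "mgraph F" using F by (simp add: four_regular_def)
  have W: "?W \<subseteq> mverts F" and finV: "finite (mverts F)"
    using w mg unfolding mgraph_def closed_trails_def by blast+
  have "\<exists>c\<in>C. \<exists>u. euler_circuit F K c \<and> u \<in> c" if K: "K \<in> components F" for K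
  proof -
    obtain c where c: "c \<in> C" "euler_circuit F K c"
      using ex1_implies_ex[OF bspec[OF conjunct2[OF C[unfolded euler_system_def]] K]] by blast
    then have "c \<noteq> {}"
      using in_quotient_imp_non_empty[OF equiv_same_circuit]
      unfolding euler_circuit_def circuits_def by blast
    with c show ?thesis by blast
  qed
  then obtain \<c> U where U: "\<And>K. K \<in> components F \<Longrightarrow>
      \<c> K \<in> C \<and> euler_circuit F K (\<c> K) \<and> U K \<in> \<c> K"
    by metis
  have "\<exists>K. K \<in> components F \<and> v \<in> K" if "v \<in> mverts F" for v
    using component_exists[OF that] by blast
  then obtain \<kappa> where \<kappa>: "\<And>v. v \<in> mverts F \<Longrightarrow> \<kappa> v \<in> components F \<and> v \<in> \<kappa> v"
    by metis
  \<comment> \<open>\<open>u v\<close> depends only on the component of \<open>v\<close>, so all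
    vertices of a component are read along the same Euler trail.\<close>
  define u where "u = (\<lambda>v. U (\<kappa> v))"
  have euler: "\<c> (\<kappa> v) \<in> C" "euler_circuit F (\<kappa> v) (\<c> (\<kappa> v))" "u v \<in> \<c> (\<kappa> v)"
    if "v \<in> mverts F" for v
    using U \<kappa> that by (auto simp: u_def)
  have u: "u v \<in> closed_trails F" if "v \<in> mverts F" for v
    using euler[OF that] circuit_memberD(1) by (auto simp: euler_circuit_def)
  have two: "card {i. i < length (u v) \<and> endpt F (u v ! i) = v} = 2" if "v \<in> mverts F" for v
    using euler_trail_visits_twice[OF F _ euler(2,3)[OF that]] \<kappa>[OF that] that by blast
  define p q where "p v = Min {i. i < length (u v) \<and> endpt F (u v ! i) = v}"
    and "q v = Max {i. i < length (u v) \<and> endpt F (u v ! i) = v}" for v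
  have less: "p v < q v" and pos: "{i. i < length (u v) \<and> endpt F (u v ! i) = v} = {p v, q v}"
    if v: "v \<in> mverts F" for v
  proof -
    obtain a b where ab: "{i. i < length (u v) \<and> endpt F (u v ! i) = v} = {a, b}" "a < b"
      by (rule card_2_ordered[OF two[OF v]])
    show "p v < q v" "{i. i < length (u v) \<and> endpt F (u v ! i) = v} = {p v, q v}"
      unfolding p_def q_def ab(1) using ab(2) by simp_all
  qed
  have qlen: "q v < length (u v)" if "v \<in> mverts F" for v
    using pos[OF that] by blast
  define f :: "'b \<times> bool \<Rightarrow> bit" where "f h = (if fst h \<in> fst ` set w then 1 else 0)" for h
  define out where "out v i = f (u v ! i)" for v i
  \<comment> \<open>\<open>f\<close> takes one value on both halves of an edge, so the entry before
    \<open>i\<close> gives the value on the arriving half-edge.\<close>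
  define inn where "inn v i = f (u v ! prev_index (u v) i)" for v i
  define change where "change v = inn v (p v) + out v (p v)" for v
  define gap where "gap v = out v (p v) + inn v (q v)" for v
  \<comment> \<open>At a vertex of \<open>w\<close>, two of the four half-edges lie on
    \<open>w\<close>. They form one passage if \<open>change v = 0\<close>; otherwise each passage
    has one of them, and \<open>gap v\<close> tells whether one arrives and one departs
    (\<open>Chi\<close>) or both are of the same kind (\<open>Psi\<close>). At other vertices of
    \<open>F\<close> both bits vanish, and the default \<open>Phi\<close> serves to complete a
    transversal.\<close>
  define lab where "lab v = (if change v = 0 then Phi v else if gap v = 0 then Chi v else Psi v)"
    for v
  \<comment> \<open>Double counting of the half-edges at \<open>v\<close> that lie on
    \<open>w\<close>: by the two passages of the Euler trail, and by \<open>w\<close>, which visits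
    \<open>v\<close> at most once. The count is in \<open>nat\<close> because \<open>GF(2)\<close>
    would not separate 0, 2 and 4.\<close>
  have count: "of_bool (out v (p v) = 1) + of_bool (inn v (p v) = 1) +
      (of_bool (out v (q v) = 1) + of_bool (inn v (q v) = 1)) = (if v \<in> ?W then 2 else (0::nat))"
    if v: "v \<in> mverts F" for v
  proof -
    let ?g = "\<lambda>h::'b \<times> bool. of_bool (f h = 1) :: nat"
    have H: "finite (half_edges F)" "set w \<subseteq> half_edges F"
      using mg w by (auto simp: mgraph_def half_edges_def closed_trails_def)
    have "(\<Sum>h | h \<in> fst ` set (u v) \<times> UNIV \<and> endpt F h = v. ?g h) =
        card {h \<in> {h \<in> half_edges F. endpt F h = v}. f h = 1}"
      unfolding euler_trail_half_edges[OF mg conjunct1[OF \<kappa>[OF v]] euler(2,3)[OF v] conjunct2[OF \<kappa>[OF v]]]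
      using H by (simp add: Int_def)
    also have "{h \<in> {h \<in> half_edges F. endpt F h = v}. f h = 1} =
        {h. h \<in> fst ` set w \<times> UNIV \<and> endpt F h = v}"
      using H(2) by (auto simp: f_def half_edges_def mem_Times_iff)
    also have "card \<dots> = 2 * card {i. i < length w \<and> endpt F (w ! i) = v}"
      using sum_half_edges_at[OF w(1), where v = v and g = "\<lambda>_. 1"] by simp
    also have "\<dots> = (if v \<in> ?W then 2 else 0)"
    proof (cases "v \<in> ?W")
      case True
      then obtain i where "i < length w" "endpt F (w ! i) = v" by (auto simp: in_set_conv_nth)
      then have "{i. i < length w \<and> endpt F (w ! i) = v} = {i}"
        using w(2) by (auto simp: distinct_conv_nth)
      with True show ?thesis by simp
    next
      case False
      then have "{i. i < length w \<and> endpt F (w ! i) = v} = {}" by auto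
      with False show ?thesis by simp
    qed
    finally have "(\<Sum>i\<in>{p v, q v}. ?g (u v ! i) + ?g (opp (u v ! prev_index (u v) i))) =
        (if v \<in> ?W then 2 else 0)"
      unfolding sum_half_edges_at[OF u[OF v]] pos[OF v] .
    moreover have "f (opp h) = f h" for h by (simp add: f_def)
    ultimately show ?thesis
      using less[OF v] by (simp add: out_def inn_def)
  qed
  \<comment> \<open>The four bits at \<open>v\<close> have an even sum, so both passages show the
    same change.\<close>
  have change_q: "inn v (q v) + out v (q v) = change v" if "v \<in> mverts F" for v
    using count[OF that] unfolding change_def
    by (cases "out v (p v)"; cases "inn v (p v)"; cases "out v (q v)"; cases "inn v (q v)")
      (auto split: if_splits)
  have off: "change v = 0" "gap v = 0" if "v \<in> mverts F" "v \<notin> ?W" for v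
    using count[OF that(1)] that(2) unfolding change_def gap_def by auto
  \<comment> \<open>Here the two half-edges on \<open>w\<close> form one passage, so the two
    half-edges compared by \<open>gap\<close> belong to different passages and exactly one is on
    \<open>w\<close>.\<close>
  have gap_1: "gap v = 1" if "v \<in> ?W" "change v = 0" for v
  proof -
    have "v \<in> mverts F" using that W by blast
    from count[OF this] that show ?thesis unfolding change_def gap_def
      by (cases "out v (p v)"; cases "inn v (p v)"; cases "out v (q v)"; cases "inn v (q v)") auto
  qed
  have telescope: "(\<Sum>v\<in>mverts F. ?A r v * change v) = gap r" if r: "r \<in> mverts F" for r
  proof -
    let ?I = "{p r<..<q r}"
    have r': "\<kappa> r \<in> components F" "r \<in> \<kappa> r" using \<kappa>[OF r] by auto
    have in_\<kappa>: "endpt F (u r ! i) \<in> \<kappa> r" if "i < length (u r)" for i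
      using euler_trail_endpt[OF euler(2,3)[OF r] that] .
    have in_V: "endpt F (u r ! i) \<in> mverts F" if "i < length (u r)" for i
    proof -
      have "u r ! i \<in> half_edges F"
        using u[OF r] nth_mem[OF that] unfolding closed_trails_def by blast
      then show ?thesis using mg unfolding mgraph_def by blast
    qed
    have same: "u v = u r" if "v \<in> mverts F" "v \<in> \<kappa> r" for v
      using components_eq[OF _ r'(1), of "\<kappa> v" v] \<kappa>[OF that(1)] that(2) by (simp add: u_def)
    have adj: "?A r v = of_nat (card {i \<in> ?I. endpt F (u r ! i) = v})"
      if v: "v \<in> mverts F" for v
    proof -
      let ?vs = "map (endpt F) (u r)"
      have card: "card {i \<in> ?I. endpt F (u r ! i) = v} =
          card {i. p r < i \<and> i < q r \<and> ?vs ! i = v}"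
        using qlen[OF r] by (intro arg_cong[where f = card]) auto
      have vs: "{i. i < length ?vs \<and> ?vs ! i = x} =
          {i. i < length (u r) \<and> endpt F (u r ! i) = x}" for x
        by auto
      note pr = vs[of r, unfolded pos[OF r]]
      have "v \<noteq> r \<and> sym_interlaced ?vs r v \<longleftrightarrow>
          odd (card {i. p r < i \<and> i < q r \<and> ?vs ! i = v})"
      proof (cases "v \<noteq> r \<and> v \<in> \<kappa> r")
        case True
        then have "card {i. i < length ?vs \<and> ?vs ! i = v} = 2"
          unfolding vs using two[OF v] same[OF v] by simp
        from sym_interlaced_iff_odd[OF pr less[OF r] this] True show ?thesis by simp
      next
        \<comment> \<open>For \<open>v = r\<close>, or \<open>v\<close> in another component, no
          inner position carries \<open>v\<close>, and both sides are false.\<close>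
        case False
        have "\<not> (p r < i \<and> i < q r \<and> ?vs ! i = v)" for i
        proof
          assume i: "p r < i \<and> i < q r \<and> ?vs ! i = v"
          then have "i < length (u r)" using qlen[OF r] by simp
          with in_\<kappa>[of i] i False have "v = r" by auto
          with i \<open>i < length (u r)\<close> have "i \<in> {i. i < length (u r) \<and> endpt F (u r ! i) = r}"
            by simp
          then have "i \<in> {p r, q r}" unfolding pos[OF r] .
          with i show False by simp
        qed
        then have "card {i. p r < i \<and> i < q r \<and> ?vs ! i = v} = 0"
          by (simp only: simp_thms Collect_empty_eq card.empty empty_def[symmetric])
        moreover have "\<not> sym_interlaced ?vs r v" if "v \<notin> \<kappa> r"
        proof
          assume "sym_interlaced ?vs r v"
          then obtain i where "i < length ?vs" "?vs ! i = v"
            unfolding sym_interlaced_def interlaced_def by (meson less_trans)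
          with in_\<kappa>[of i] that show False by auto
        qed
        ultimately show ?thesis using False by (metis even_zero)
      qed
      then show ?thesis
        unfolding adjacency_matrix_def card bit_of_nat
          interlacement_graph_edge_iff[OF mg C r'(1) euler[OF r] r r'(2) v] by simp
    qed
    \<comment> \<open>\<open>?A r v\<close> counts modulo 2 the positions of \<open>v\<close>
      strictly between the passages of \<open>r\<close>; exchanging the sums turns vertices into
      positions.\<close>
    have "(\<Sum>v\<in>mverts F. ?A r v * change v) =
        (\<Sum>v\<in>mverts F. \<Sum>i\<in>?I. if endpt F (u r ! i) = v then change v else 0)"
      by (rule sum.cong[OF refl]) (simp only: adj sum_if_const[OF finite_greaterThanLessThan])
    also have "\<dots> = (\<Sum>i\<in>?I. \<Sum>v\<in>mverts F. if endpt F (u r ! i) = v then change v else 0)"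
      by (rule sum.swap)
    also have "\<dots> = (\<Sum>i\<in>?I. out r (i - 1) + out r i)"
    proof (rule sum.cong)
      fix i assume i: "i \<in> ?I"
      then have il: "i < length (u r)" using qlen[OF r] by simp
      let ?v = "endpt F (u r ! i)"
      have eq: "u ?v = u r" using same in_V in_\<kappa> il by blast
      have "i \<in> {i. i < length (u ?v) \<and> endpt F (u ?v ! i) = ?v}"
        using il by (simp add: eq)
      then have "i \<in> {p ?v, q ?v}" unfolding pos[OF in_V[OF il]] .
      \<comment> \<open>Position \<open>i\<close> may be either passage of its vertex; by
        \<open>change_q\<close> the change is the same at both.\<close>
      then have "change ?v = inn ?v i + out ?v i"
        using change_q[OF in_V[OF il]] by (auto simp: change_def)
      also have "\<dots> = out r (i - 1) + out r i"
        using i by (simp add: inn_def out_def eq prev_index_def)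
      finally show "(\<Sum>v\<in>mverts F. if ?v = v then change v else 0) = out r (i - 1) + out r i"
        unfolding sum.delta'[OF finV] using in_V[OF il] by simp
    qed simp
    \<comment> \<open>As \<open>q r > p r\<close> excludes position 0, \<open>prev_index\<close>
      does not wrap around and \<open>out r (q r - 1)\<close> is \<open>inn r (q r)\<close>.\<close>
    also have "\<dots> = gap r"
      unfolding sum_telescope_char_2[OF bit_add_self less[OF r]] gap_def
      using less[OF r] by (simp add: inn_def out_def prev_index_def)
    finally show ?thesis .
  qed
  show thesis
  proof (rule that)
    show "lab v \<in> vertex_triple v" for v by (simp add: lab_def vertex_triple_def)
    fix r assume r: "r \<in> mverts F"
    \<comment> \<open>By \<open>gap_1\<close> the pair of \<open>change v\<close> and
      \<open>gap v\<close> is (0, 1), (1, 0) or (1, 1): the coefficients of the \<open>A\<close> and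
      \<open>I\<close> parts in \<open>Phi\<close>, \<open>Chi\<close> and
      \<open>Psi\<close>.\<close>
    have "IAS (interlacement_graph F C) r (lab v) = ?A r v * change v + (if r = v then gap v else 0)"
      if "v \<in> ?W" for v
      using gap_1[OF that] by (cases "change v"; cases "gap v")
        (auto simp: lab_def identity_matrix_def)
    then have "(\<Sum>v\<in>?W. IAS (interlacement_graph F C) r (lab v)) =
        (\<Sum>v\<in>?W. ?A r v * change v) + (\<Sum>v\<in>?W. if r = v then gap v else 0)"
      unfolding sum.distrib[symmetric] by (rule sum.cong[OF refl])
    also have "(\<Sum>v\<in>?W. ?A r v * change v) = (\<Sum>v\<in>mverts F. ?A r v * change v)"
      by (rule sum.mono_neutral_left) (use finV W off in auto)
    also have "\<dots> = gap r" by (rule telescope[OF r])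
    \<comment> \<open>If \<open>r\<close> is not on \<open>w\<close>, the sum is empty of
      \<open>r\<close>, and \<open>gap r = 0\<close> by \<open>off\<close>.\<close>
    also have "(\<Sum>v\<in>?W. if r = v then gap v else 0) = gap r"
      unfolding sum.delta'[OF finite_imageI[OF finite_set]] using off(2)[OF r] by auto
    finally show "(\<Sum>v\<in>?W. IAS (interlacement_graph F C) r (lab v)) = 0"
      by (simp only: bit_add_self)
  qed
qed

theorem theorem5:
  fixes F :: "('v, 'e) mgraph"
    and C :: "('e \<times> bool) list set set"
    and G :: "'v sgraph"
    and k :: nat
  assumes "four_regular F"
    and "euler_system F C"
    and "G = interlacement_graph F C"
    and "k > 0"
    and "\<exists>c\<in>circuits F. circuit_size c = k"
  shows "\<exists>X. transverse_circuit G X \<and> card X \<le> k"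
proof -
  obtain c where c: "c \<in> circuits F" "circuit_size c = k" using assms(5) by blast
  then obtain w0 where "w0 \<in> c"
    using in_quotient_imp_non_empty[OF equiv_same_circuit] unfolding circuits_def by blast
  then have w0: "w0 \<in> closed_trails F" "length w0 = k"
    using circuit_memberD(1,2)[OF c(1)] c(2) distinct_card[of "map fst w0"]
    by (auto simp: circuit_size_def closed_trails_def)
  \<comment> \<open>The minimum is over all closed trails of \<open>F\<close>: a shortest one need
    not come from \<open>c\<close>, but its length is at most \<open>k\<close>.\<close>
  obtain w where w: "w \<in> closed_trails F" "\<And>w'. w' \<in> closed_trails F \<Longrightarrow> length w \<le> length w'"
    using exists_least_iff[of "\<lambda>n. \<exists>w\<in>closed_trails F. length w = n"] w0
    by (metis not_le)
  then have len: "length w \<le> k" using w0 by blast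
  let ?W = "endpt F ` set w"
  obtain lab where lab: "\<And>v. lab v \<in> vertex_triple v"
    and zero: "\<And>r. r \<in> mverts F \<Longrightarrow> (\<Sum>v\<in>?W. IAS G r (lab v)) = 0"
    using trail_labels_sum_zero[OF assms(1,2) w(1) shortest_closed_trail_distinct[OF w]] assms(3)
    by blast
  have V: "sverts G = mverts F" by (simp add: assms(3) interlacement_graph_def)
  have W: "?W \<subseteq> mverts F" "?W \<noteq> {}"
    using w(1) assms(1) unfolding four_regular_def mgraph_def closed_trails_def by auto
  have disj: "v = v'" if "x \<in> vertex_triple v" "x \<in> vertex_triple v'" for x and v v' :: 'v
    using that by (auto simp: vertex_triple_def)
  have inj: "inj_on lab ?W" using disj lab by (metis inj_onI)
  have dep: "\<not> indep (isotropic_matroid G) (lab ` ?W)"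
  proof
    assume "indep (isotropic_matroid G) (lab ` ?W)"
    then have ind: "(\<forall>r\<in>mverts F. (\<Sum>x\<in>lab ` ?W. a x * IAS G r x) = 0) \<longrightarrow>
        (\<forall>x\<in>lab ` ?W. a x = 0)" for a
      by (simp add: isotropic_matroid_def matrix_matroid_def V)
    \<comment> \<open>All coefficients are 1; as \<open>lab\<close> is injective, the sum over
      labels is the vanishing sum over visited vertices.\<close>
    have "\<forall>r\<in>mverts F. (\<Sum>x\<in>lab ` ?W. 1 * IAS G r x) = 0"
      unfolding sum.reindex[OF inj] comp_def mult_1 using zero by blast
    with ind[of "\<lambda>_. 1"] W(2) show False by auto
  qed
  have "lab ` ?W \<subseteq> ground (isotropic_matroid G)"
    using lab W(1) by (auto simp: isotropic_matroid_def matrix_matroid_def W_def V)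
  then obtain X where X: "X \<subseteq> lab ` ?W" "matroid_circuit (isotropic_matroid G) X"
    by (rule dependent_contains_circuit[OF finite_imageI[OF finite_imageI[OF finite_set]] _ dep])
  \<comment> \<open>The labels of the unvisited vertices extend the dependent set to a
    transversal.\<close>
  have "transversal G (lab ` mverts F)"
    unfolding transversal_def V
  proof (intro conjI ballI)
    show "lab ` mverts F \<subseteq> W G" using lab by (auto simp: W_def V)
    show "\<exists>!x. x \<in> lab ` mverts F \<inter> vertex_triple v" if "v \<in> mverts F" for v
      using lab disj that by (intro ex1I[of _ "lab v"]) blast+
  qed
  then have "transverse_circuit G X"
    unfolding transverse_circuit_def using X W(1) by blast
  moreover have "card X \<le> card (lab ` ?W)" using X(1) by (simp add: card_mono)
  moreover have "\<dots> \<le> length w"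
    using card_length[of "map (lab \<circ> endpt F) w"] by (simp add: image_comp comp_def image_image)
  ultimately show ?thesis using len by (meson order.trans)
qed

end
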